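(* Consider the normed space $(\mathbb{R}^2,\lVert\cdot\rVert_\infty)$. Define $h:\mathbb{R}^2\to[0,\infty)$ and $T:\mathbb{R}^2\to\mathbb{R}^2$ by $$h(s,t)=\max\left\{|t|,\,s/3,\,-s\right\},\qquad T(s,t)=\left(\frac{s+h(s,t)}{2},\,0\right).$$ Then $T$ is continuous and is a $P$-contraction with constant $\beta=1/2$. Nevertheless, $T$ is not an enriched contraction.
   Context: Here $\lVert (s,t)\rVert_\infty=\max\{|s|,|t|\}$ on $\mathbb{R}^2$. Let $C$ be a nonempty subset of a normed linear space $(X,\lVert\cdot\rVert)$ and let $T:C\to C$ be a mapping (in the claim, $C=X=\mathbb{R}^2$). $T$ is called a $P$-contraction if there exists $\beta\in[0,1)$ such that for all $x,y\in C$, $$\lVert Tx-Ty\rVert\leq \beta\left(\lVert x-y\rVert+\bigl|\lVert x-Tx\rVert-\lVert y-Ty\rVert\bigr|\right);$$ it is a $P$-contraction with constant $\beta$ if this inequality holds for all $x,y\in C$ with that particular $\beta$. $T$ is called an enriched contraction if there exist constants $b\geq 0$ and $\theta\in[0,b+1)$ such that for all $x,y\in C$, $$\lVert b(x-y)+Tx-Ty\rVert\leq\theta\lVert x-y\rVert.$$ *)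

theory Defs
  imports "HOL-Analysis.Analysis"
begin

(* The norm is an explicit parameter, because the type class norm on products is
   Euclidean, while the maximum norm is needed below. *)
locale normed_linear_space =
  fixes N :: "'a::real_vector \<Rightarrow> real"
  assumes norm_eq_0_iff: "N x = 0 \<longleftrightarrow> x = 0"
    and norm_scaleR: "N (a *\<^sub>R x) = \<bar>a\<bar> * N x"
    and norm_triangle: "N (x + y) \<le> N x + N y"
begin

lemma norm_minus: "N (- x) = N x"
  using norm_scaleR[of "-1" x] by simp

lemma norm_nonneg: "0 \<le> N x"
  using norm_triangle[of x "- x"] norm_eq_0_iff[of 0] by (simp add: norm_minus)

sublocale Metric_space UNIV "\<lambda>x y. N (x - y)"
proof
  fix x y z :: 'a
  show "0 \<le> N (x - y)" by (rule norm_nonneg)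
  show "N (x - y) = N (y - x)" using norm_minus[of "x - y"] by simp
  show "N (x - y) = 0 \<longleftrightarrow> x = y" by (simp add: norm_eq_0_iff)
  show "N (x - z) \<le> N (x - y) + N (y - z)" using norm_triangle[of "x - y" "y - z"] by simp
qed

definition P_contraction_with :: "real \<Rightarrow> 'a set \<Rightarrow> ('a \<Rightarrow> 'a) \<Rightarrow> bool" where
  "P_contraction_with \<beta> C T \<longleftrightarrow>
     C \<noteq> {} \<and> T \<in> C \<rightarrow> C \<and> 0 \<le> \<beta> \<and> \<beta> < 1 \<and>
     (\<forall>x\<in>C. \<forall>y\<in>C. N (T x - T y) \<le> \<beta> * (N (x - y) + \<bar>N (x - T x) - N (y - T y)\<bar>))"

definition enriched_contraction :: "'a set \<Rightarrow> ('a \<Rightarrow> 'a) \<Rightarrow> bool" where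
  "enriched_contraction C T \<longleftrightarrow>
     C \<noteq> {} \<and> T \<in> C \<rightarrow> C \<and>
     (\<exists>b \<theta>. 0 \<le> b \<and> 0 \<le> \<theta> \<and> \<theta> < b + 1 \<and>
       (\<forall>x\<in>C. \<forall>y\<in>C. N (b *\<^sub>R (x - y) + T x - T y) \<le> \<theta> * N (x - y)))"

end

definition max_norm :: "real \<times> real \<Rightarrow> real" where
  "max_norm = (\<lambda>(s, t). max \<bar>s\<bar> \<bar>t\<bar>)"

interpretation max_norm: normed_linear_space max_norm
proof
  fix x y :: "real \<times> real" and a :: real
  show "max_norm x = 0 \<longleftrightarrow> x = 0"
    by (cases x) (auto simp: max_norm_def zero_prod_def max_def)
  show "max_norm (a *\<^sub>R x) = \<bar>a\<bar> * max_norm x"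
    by (cases x) (simp add: max_norm_def abs_mult max_mult_distrib_left)
  show "max_norm (x + y) \<le> max_norm x + max_norm y"
    by (cases x; cases y) (auto simp: max_norm_def)
qed

definition h :: "real \<times> real \<Rightarrow> real" where
  "h = (\<lambda>(s, t). Max {\<bar>t\<bar>, s / 3, - s})"

definition T :: "real \<times> real \<Rightarrow> real \<times> real" where
  "T = (\<lambda>(s, t). ((s + h (s, t)) / 2, 0))"

end

theory Submission
  imports Defs
begin

text \<open>The function \<open>h\<close> is the displacement \<open>\<parallel>x - T x\<parallel>\<close>, so the P-contraction inequality is the
  triangle inequality for \<open>(s + h (s, t)) / 2\<close>. As \<open>h\<close> is nonexpansive, so is \<open>T\<close>, whence
  continuity. On the diagonal \<open>T (a, a) = (a, 0)\<close> for \<open>a \<ge> 0\<close>, so \<open>b (x - y) + T x - T y\<close> has norm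
  \<open>(b + 1) \<parallel>x - y\<parallel>\<close> there, which excludes every enriched contraction constant.\<close>

lemma h_nonneg: "0 \<le> h x"
  by (cases x) (simp add: h_def max_def)

text \<open>For \<open>x = (s, t)\<close>, the bound
  \<open>\<bar>s - h x\<bar> / 2 \<le> h x\<close> amounts to \<open>s / 3 \<le> h x\<close> and
  \<open>- s \<le> h x\<close>. It is an equality if one of these is; otherwise
  \<open>h x = \<bar>t\<bar>\<close>.\<close>

lemma max_norm_displacement: "max_norm (x - T x) = h x"
  by (cases x) (auto simp: max_norm_def T_def h_def max_def field_simps abs_if)

text \<open>A maximum of 1-Lipschitz functions is 1-Lipschitz.\<close>

lemma h_nonexpansive: "\<bar>h x - h y\<bar> \<le> max_norm (x - y)"
  by (cases x; cases y) (auto simp: max_norm_def h_def max_def)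

lemma max_norm_T_diff: "max_norm (T x - T y) = \<bar>(fst x - fst y) + (h x - h y)\<bar> / 2"
proof -
  have "T x - T y = (((fst x - fst y) + (h x - h y)) / 2, 0)"
    by (simp add: T_def split_beta field_simps)
  then show ?thesis
    by (simp add: max_norm_def)
qed

lemma abs_fst_le_max_norm: "\<bar>fst x\<bar> \<le> max_norm x"
  by (cases x) (simp add: max_norm_def)

lemma max_norm_T_diff_le: "max_norm (T x - T y) \<le> 1/2 * (max_norm (x - y) + \<bar>h x - h y\<bar>)"
  using abs_fst_le_max_norm[of "x - y"] by (simp add: max_norm_T_diff)

lemma T_nonexpansive: "max_norm (T x - T y) \<le> max_norm (x - y)"
  using max_norm_T_diff_le[of x y] h_nonexpansive[of x y] by simp

lemma continuous_T: "continuous_map max_norm.mtopology max_norm.mtopology T"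
  unfolding max_norm.metric_continuous_map[OF max_norm.Metric_space_axioms]
  \<comment> \<open>In the epsilon-delta condition, delta = epsilon works.\<close>
  using T_nonexpansive le_less_trans by blast

lemma P_contraction_T: "max_norm.P_contraction_with (1/2) UNIV T"
  using max_norm_T_diff_le
  by (simp add: max_norm.P_contraction_with_def max_norm_displacement)

lemma not_enriched_contraction_T: "\<not> max_norm.enriched_contraction UNIV T"
proof
  assume "max_norm.enriched_contraction UNIV T"
  then obtain b \<theta> where b: "0 \<le> b" "\<theta> < b + 1"
    and "\<And>x y. max_norm (b *\<^sub>R (x - y) + T x - T y) \<le> \<theta> * max_norm (x - y)"
    by (auto simp: max_norm.enriched_contraction_def)
  \<comment> \<open>The vector on the left is \<open>(b + 1, b)\<close>: the second coordinate
    raises \<open>h (1, 1)\<close> to \<open>1\<close>.\<close>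
  from this(3)[of "(1, 1)" "(0, 0)"] have "b + 1 \<le> \<theta>"
    using b by (simp add: max_norm_def T_def h_def)
  with b show False by simp
qed

theorem theorem3p1:
  "h \<in> UNIV \<rightarrow> {0..} \<and>
   continuous_map max_norm.mtopology max_norm.mtopology T \<and>
   max_norm.P_contraction_with (1/2) UNIV T \<and>
   \<not> max_norm.enriched_contraction UNIV T"
  using h_nonneg continuous_T P_contraction_T not_enriched_contraction_T by simp

end
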